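(* Let $\mathcal T$ be a subdivision of $Q$ and suppose that the upper-level objective functional satisfies a quadratic growth condition for a solution $(\bar\beta,\bar y,\bar u)$ of (OVR) in the sense that $$F(\beta,y_\beta,u_\beta)\ge F(\bar\beta,\bar y,\bar u)+G\|\beta-\bar\beta\|_{\mathbb R^n}^2\qquad\forall\beta\in Q$$ holds for some constant $G>0$. Let $T\in\mathcal T$ be an element satisfying $$\operatorname{diam}(T)<\frac{G}{L_M(1+\|S\|)\sqrt{\frac{2C_\rho C_\varphi}{\mu}}}\,\operatorname{dist}(T,\bar\beta)^2 .$$ Then for any point $(\beta,y,u)$ with $\beta\in T$, $f(\beta,y,u)\le\xi_T(\beta)$, $Ay-Bu=0$, $u\in U_{ad}$, we have $F(\beta,y,u)>F(\bar\beta,\bar y,\bar u)$.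
   Context: **Standing setting.** $Y,U$ are real Hilbert spaces with duals $Y^*,U^*$. $Q\subset\mathbb R^n$ is a nonempty bounded polyhedron (intersection of finitely many closed halfspaces) with nonempty interior. $U_{ad}\subset U$ is nonempty, closed, convex. $A\in L[Y,Y^*]$ is an isomorphism, $B\in L[U,Y^*]$ is bounded linear, $S:=A^{-1}B\in L[U,Y]$. The functionals $F,f:Q\times Y\times U\to\mathbb R$ are bounded from below, convex and continuously Fréchet differentiable. For every $M\ge 0$ there is $L_M\ge 0$ such that $\|f'_\beta(\beta_1,y_1,u_1)-f'_\beta(\beta_2,y_2,u_2)\|\le L_M(\|\beta_1-\beta_2\|+\|y_1-y_2\|_Y+\|u_1-u_2\|_U)$, $|F(\beta,y_1,u_1)-F(\beta,y_2,u_2)|\le L_M(\|y_1-y_2\|_Y+\|u_1-u_2\|_U)$, $\|f'_u(\beta_1,S(u),u)-f'_u(\beta_2,S(u),u)\|_{U^*}\le L_M\|\beta_1-\beta_2\|$, $\|f'_y(\beta_1,S(u),u)-f'_y(\beta_2,S(u),u)\|_{Y^*}\le L_M\|\beta_1-\beta_2\|$ for all $\beta,\beta_1,\beta_2\in Q$, all $y_1,y_2\in Y$ of norm $\le M$ and all $u,u_1,u_2\in U_{ad}$ of norm $\le M$. There is $\mu>0$ such that for all $\beta\in Q$, $u_1,u_2\in U_{ad}$: $f(\beta,S(u_2),u_2)\ge f(\beta,S(u_1),u_1)+\langle f'_y(\cdot),S(u_2-u_1)\rangle+\langle f'_u(\cdot),u_2-u_1\rangle+\frac\mu2\|u_2-u_1\|_U^2$,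 with derivatives taken at $(\beta,S(u_1),u_1)$. **Notation.** For $\beta\in Q$, $(y_\beta,u_\beta)$ is the unique minimizer of $f(\beta,y,u)$ over $(y,u)\in Y\times U_{ad}$ with $Ay=Bu$, and $\varphi(\beta):=f(\beta,y_\beta,u_\beta)$. Problem (OVR): minimize $F(\beta,y,u)$ subject to $\beta\in Q$, $f(\beta,y,u)\le\varphi(\beta)$, $Ay-Bu=0$, $u\in U_{ad}$. A subdivision of $Q$ is a finite set of non-degenerate $n$-simplices with union $Q$; $\xi_T:T\to\mathbb R$ is the affine interpolant of $\varphi$ in the vertices of $T$; $\rho(T):=\operatorname{diam}(B_T)/\operatorname{diam}(T)$ with $B_T$ the largest ball contained in $T$. **Constants.** One has $\varphi\in W^{2,\infty}(Q)$ and $C_\varphi:=\|\varphi\|_{W^{2,\infty}(Q)}$. $\rho>0$ is a lower bound for the aspect ratios $\rho(T)$, $T\in\mathcal T$, and $C_\rho>0$ is a constant, depending only on $n$ and $\rho$, of the interpolation estimate $\|\xi_T-\varphi\|_{L^\infty(T)}\le C_\rho\operatorname{diam}(T)^2\|\varphi\|_{W^{2,\infty}(T)}$, valid for simplices $T\subset Q$ with $\rho(T)\ge\rho$. $M_\Psi\ge0$ is a constant with $\|\beta\|,\|y_\beta\|_Y,\|u_\beta\|_U\le M_\Psi$ for all $\beta\in Q$ (such a constant exists). $M:=M_\Psi+\max\{1,\|S\|\}\sqrt{2C_\rho C_\varphi/\mu}\,\operatorname{diam}(Q)$, and $L_M$ is the Lipschitz constant from the standing setting for this $M$. *)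

theory Defs
  imports "HOL-Analysis.Analysis" "HOL-Probability.Essential_Supremum"
begin

section \<open>Operators and derivatives\<close>

definition isomorphism :: "('a::real_normed_vector \<Rightarrow>\<^sub>L 'b::real_normed_vector) \<Rightarrow> bool" where
  "isomorphism A \<longleftrightarrow> (\<exists>A'. A' o\<^sub>L A = id_blinfun \<and> A o\<^sub>L A' = id_blinfun)"

definition inverse_op :: "('a::real_normed_vector \<Rightarrow>\<^sub>L 'b::real_normed_vector) \<Rightarrow> ('b \<Rightarrow>\<^sub>L 'a)" where
  "inverse_op A = (THE A'. A' o\<^sub>L A = id_blinfun \<and> A o\<^sub>L A' = id_blinfun)"

text \<open>
  The derivative is taken within \<open>D\<close>. The sets used below are convex with nonempty interior,
  so it is unique also at boundary points.
\<close>
definition cont_frechet_differentiable_on ::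
    "('a::real_normed_vector \<Rightarrow> 'b::real_normed_vector) \<Rightarrow> 'a set \<Rightarrow> bool" where
  "cont_frechet_differentiable_on f D \<longleftrightarrow>
     f differentiable_on D \<and>
     continuous_on D (\<lambda>p. Blinfun (frechet_derivative f (at p within D)))"

definition deriv_beta ::
    "'n::real_normed_vector set \<Rightarrow> ('n \<times> 'y \<times> 'u \<Rightarrow> real) \<Rightarrow> 'n \<Rightarrow> 'y \<Rightarrow> 'u \<Rightarrow> ('n \<Rightarrow>\<^sub>L real)" where
  "deriv_beta Q f \<beta> y u = Blinfun (frechet_derivative (\<lambda>b. f (b, y, u)) (at \<beta> within Q))"

definition deriv_y ::
    "('n \<times> 'y::real_normed_vector \<times> 'u \<Rightarrow> real) \<Rightarrow> 'n \<Rightarrow> 'y \<Rightarrow> 'u \<Rightarrow> ('y \<Rightarrow>\<^sub>L real)" where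
  "deriv_y f \<beta> y u = Blinfun (frechet_derivative (\<lambda>z. f (\<beta>, z, u)) (at y))"

definition deriv_u ::
    "('n \<times> 'y \<times> 'u::real_normed_vector \<Rightarrow> real) \<Rightarrow> 'n \<Rightarrow> 'y \<Rightarrow> 'u \<Rightarrow> ('u \<Rightarrow>\<^sub>L real)" where
  "deriv_u f \<beta> y u = Blinfun (frechet_derivative (\<lambda>v. f (\<beta>, y, v)) (at u))"


section \<open>Lower-level problem and optimal value reformulation\<close>

definition lower_sol ::
    "('n \<times> 'y \<times> 'u \<Rightarrow> real) \<Rightarrow> ('y::real_normed_vector \<Rightarrow>\<^sub>L 'd::real_normed_vector) \<Rightarrow>
     ('u::real_normed_vector \<Rightarrow>\<^sub>L 'd) \<Rightarrow> 'u set \<Rightarrow> 'n \<Rightarrow> 'y \<times> 'u" where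
  "lower_sol f A B Uad \<beta> =
     (THE p. is_arg_min (\<lambda>(y, u). f (\<beta>, y, u)) (\<lambda>(y, u). u \<in> Uad \<and> A y = B u) p)"

definition opt_value ::
    "('n \<times> 'y \<times> 'u \<Rightarrow> real) \<Rightarrow> ('y::real_normed_vector \<Rightarrow>\<^sub>L 'd::real_normed_vector) \<Rightarrow>
     ('u::real_normed_vector \<Rightarrow>\<^sub>L 'd) \<Rightarrow> 'u set \<Rightarrow> 'n \<Rightarrow> real" where
  "opt_value f A B Uad \<beta> =
     f (\<beta>, fst (lower_sol f A B Uad \<beta>), snd (lower_sol f A B Uad \<beta>))"

definition solves_OVR ::
    "'n set \<Rightarrow> 'u set \<Rightarrow> ('y::real_normed_vector \<Rightarrow>\<^sub>L 'd::real_normed_vector) \<Rightarrow>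
     ('u::real_normed_vector \<Rightarrow>\<^sub>L 'd) \<Rightarrow> ('n \<times> 'y \<times> 'u \<Rightarrow> real) \<Rightarrow> ('n \<times> 'y \<times> 'u \<Rightarrow> real) \<Rightarrow>
     'n \<times> 'y \<times> 'u \<Rightarrow> bool" where
  "solves_OVR Q Uad A B f F p \<longleftrightarrow>
     is_arg_min F
       (\<lambda>(\<beta>, y, u). \<beta> \<in> Q \<and> f (\<beta>, y, u) \<le> opt_value f A B Uad \<beta> \<and> A y - B u = 0 \<and> u \<in> Uad) p"


section \<open>Subdivisions and interpolation\<close>

definition subdivision :: "(real ^ 'n) set \<Rightarrow> (real ^ 'n) set set \<Rightarrow> bool" where
  "subdivision Q \<T> \<longleftrightarrow> finite \<T> \<and> (\<forall>T\<in>\<T>. int CARD('n) simplex T) \<and> \<Union>\<T> = Q"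

definition aspect_ratio :: "'a::euclidean_space set \<Rightarrow> real" where
  "aspect_ratio T =
     Sup {diameter (cball c r) | c r. r \<ge> 0 \<and> cball c r \<subseteq> T} / diameter T"

text \<open>
  On a non-degenerate simplex of full dimension the affine interpolant extends uniquely to an
  affine function on the whole space; this extension is used here.
\<close>
definition affine_interpolant :: "('a::euclidean_space \<Rightarrow> real) \<Rightarrow> 'a set \<Rightarrow> 'a \<Rightarrow> real" where
  "affine_interpolant \<phi> T =
     (THE \<xi>. (\<exists>a b. \<forall>x. \<xi> x = a \<bullet> x + b) \<and> (\<forall>v. v extreme_point_of T \<longrightarrow> \<xi> v = \<phi> v))"


section \<open>The Sobolev norm of order two with exponent infinity\<close>

coinductive smooth :: "('a::euclidean_space \<Rightarrow> real) \<Rightarrow> bool" where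
  "\<lbrakk>\<forall>x. \<psi> differentiable (at x);
    \<forall>i\<in>Basis. smooth (\<lambda>x. frechet_derivative \<psi> (at x) i)\<rbrakk> \<Longrightarrow> smooth \<psi>"

definition test_functions :: "'a::euclidean_space set \<Rightarrow> ('a \<Rightarrow> real) set" where
  "test_functions \<Omega> =
     {\<psi>. smooth \<psi> \<and> compact (closure {x. \<psi> x \<noteq> 0}) \<and> closure {x. \<psi> x \<noteq> 0} \<subseteq> \<Omega>}"

definition locally_integrable :: "'a::euclidean_space set \<Rightarrow> ('a \<Rightarrow> real) \<Rightarrow> bool" where
  "locally_integrable \<Omega> v \<longleftrightarrow> (\<forall>K\<subseteq>\<Omega>. compact K \<longrightarrow> set_integrable lebesgue K v)"

definition weak_partial ::
    "'a::euclidean_space set \<Rightarrow> 'a \<Rightarrow> ('a \<Rightarrow> real) \<Rightarrow> ('a \<Rightarrow> real) \<Rightarrow> bool" where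
  "weak_partial \<Omega> i v g \<longleftrightarrow>
     locally_integrable \<Omega> v \<and> locally_integrable \<Omega> g \<and>
     (\<forall>\<psi>\<in>test_functions \<Omega>.
        (LINT x:\<Omega>|lebesgue. v x * frechet_derivative \<psi> (at x) i)
          = - (LINT x:\<Omega>|lebesgue. g x * \<psi> x))"

definition Linf_norm :: "'a::euclidean_space set \<Rightarrow> ('a \<Rightarrow> real) \<Rightarrow> ereal" where
  "Linf_norm \<Omega> v = esssup (lebesgue_on \<Omega>) (\<lambda>x. ereal \<bar>v x\<bar>)"

text \<open>
  The norm is the maximum of the \<open>L\<^sup>\<infinity>\<close> norms of all weak derivatives of order at most
  two, for \<open>\<Omega>\<close> open. Weak derivatives are unique up to null sets, so the infimum below ranges
  over representatives with the same value, and it is \<open>\<infinity>\<close> if there are none.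
\<close>
definition W2inf_norm :: "'a::euclidean_space set \<Rightarrow> ('a \<Rightarrow> real) \<Rightarrow> ereal" where
  "W2inf_norm \<Omega> v =
     Inf {Sup ({Linf_norm \<Omega> v} \<union> {Linf_norm \<Omega> (g i) | i. i \<in> Basis}
                \<union> {Linf_norm \<Omega> (h i j) | i j. i \<in> Basis \<and> j \<in> Basis}) | g h.
            (\<forall>i\<in>Basis. weak_partial \<Omega> i v (g i)) \<and>
            (\<forall>i\<in>Basis. \<forall>j\<in>Basis. weak_partial \<Omega> j (g i) (h i j))}"

definition W2inf :: "'a::euclidean_space set \<Rightarrow> ('a \<Rightarrow> real) set" where
  "W2inf \<Omega> = {v. W2inf_norm \<Omega> v < \<infinity>}"

end

theory Submission
  imports Defs
begin

text \<open>
  The idea is to compare the given point with the lower-level solution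
  \<open>(y\<^sub>\<beta>, u\<^sub>\<beta>)\<close> for the same parameter. Strong convexity of the reduced functional makes its
  values grow at least like \<open>\<mu> / 2 * (norm (u - u\<^sub>\<beta>))\<^sup>2\<close> away from the minimizer
  (\<open>quadratic_growth_at_minimizer\<close>). The relaxed constraint bounds this growth by the
  interpolation error \<open>\<xi>\<^sub>T(\<beta>) - \<phi>(\<beta>) \<le> C\<^sub>\<rho> C\<^sub>\<phi> diam(T)\<^sup>2\<close>, so \<open>u\<close> and \<open>y = S u\<close> are within
  a distance of order \<open>diam(T)\<close> of \<open>u\<^sub>\<beta>\<close> and \<open>y\<^sub>\<beta>\<close>. By the Lipschitz estimate \<open>F\<close> then loses
  at most a multiple of \<open>diam(T)\<close> against \<open>F(\<beta>, y\<^sub>\<beta>, u\<^sub>\<beta>)\<close>, and the assumed bound on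
  \<open>diam(T)\<close> says that the quadratic upper-level growth outweighs this loss.

  Two points need care. First, the lower-level solution and the interpolant are given by
  definite descriptions, so their existence and uniqueness have to be shown
  (\<open>strongly_convex_attains_minimum\<close>, \<open>affine_interpolation_on_simplex\<close>). Second, the
  interpolation estimate only holds almost everywhere, whereas it is used at the
  particular point \<open>\<beta>\<close>. To pass to the point, freeze the lower-level solution at \<open>\<beta>\<close>. This
  gives the continuous majorant \<open>b \<mapsto> f(b, y\<^sub>\<beta>, u\<^sub>\<beta>)\<close> of \<open>\<phi>\<close>, which agrees with
  \<open>\<phi>\<close> at \<open>\<beta>\<close>; an a.e. upper bound on \<open>\<xi>\<^sub>T - \<phi>\<close> is thus one for the continuous minorant
  \<open>b \<mapsto> \<xi>\<^sub>T(b) - f(b, y\<^sub>\<beta>, u\<^sub>\<beta>)\<close>, and for continuous functions on a convex body it holds everywhere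
  (\<open>continuous_AE_bound_everywhere\<close>).
\<close>


section \<open>Strongly convex functions and their minimizers\<close>

text \<open>
  The inequality between function values, rather than the one with gradients, since it can be
  used directly at points that are only known to be minimal or nearly minimal.
\<close>
definition strongly_convex_on ::
    "real \<Rightarrow> 'u::real_normed_vector set \<Rightarrow> ('u \<Rightarrow> real) \<Rightarrow> bool" where
  "strongly_convex_on \<mu> C h \<longleftrightarrow> (\<forall>x\<in>C. \<forall>z\<in>C. \<forall>t. 0 \<le> t \<and> t \<le> 1 \<longrightarrow>
     h ((1 - t) *\<^sub>R x + t *\<^sub>R z) + \<mu> / 2 * t * (1 - t) * (norm (z - x))\<^sup>2
       \<le> (1 - t) * h x + t * h z)"

text \<open>
  The gradient inequality at the convex combination, applied in the directions of both
  endpoints and averaged: the linear terms cancel.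
\<close>
lemma strongly_convex_on_if_gradient_inequality:
  fixes h :: "'u::real_normed_vector \<Rightarrow> real"
  assumes "convex C"
    and lin: "\<And>x. linear (D x)"
    and grad: "\<And>x z. x \<in> C \<Longrightarrow> z \<in> C \<Longrightarrow>
      h z \<ge> h x + D x (z - x) + \<mu> / 2 * (norm (z - x))\<^sup>2"
  shows "strongly_convex_on \<mu> C h"
  unfolding strongly_convex_on_def
proof (intro ballI allI impI, elim conjE)
  fix x z and t :: real
  assume C: "x \<in> C" "z \<in> C" and t: "0 \<le> t" "t \<le> 1"
  define m where "m = (1 - t) *\<^sub>R x + t *\<^sub>R z"
  have m: "m \<in> C"
    unfolding m_def using \<open>convex C\<close> C t by (simp add: convex_alt)
  interpret D: linear "D m" by (rule lin)
  have dx: "x - m = (- t) *\<^sub>R (z - x)" and dz: "z - m = (1 - t) *\<^sub>R (z - x)"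
    by (simp_all add: m_def algebra_simps)
  have "h x \<ge> h m + (- t) * D m (z - x) + \<mu> / 2 * (t\<^sup>2 * (norm (z - x))\<^sup>2)"
    using grad[OF m C(1)] unfolding dx D.scaleR norm_scaleR by (simp add: power_mult_distrib)
  then have 1: "(1 - t) * (h m + (- t) * D m (z - x) + \<mu> / 2 * (t\<^sup>2 * (norm (z - x))\<^sup>2)) \<le> (1 - t) * h x"
    using t by (intro mult_left_mono) auto
  have "h z \<ge> h m + (1 - t) * D m (z - x) + \<mu> / 2 * ((1 - t)\<^sup>2 * (norm (z - x))\<^sup>2)"
    using grad[OF m C(2)] unfolding dz D.scaleR norm_scaleR by (simp add: power_mult_distrib)
  then have 2: "t * (h m + (1 - t) * D m (z - x) + \<mu> / 2 * ((1 - t)\<^sup>2 * (norm (z - x))\<^sup>2)) \<le> t * h z"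
    using t by (intro mult_left_mono) auto
  have "h m + \<mu> / 2 * t * (1 - t) * (norm (z - x))\<^sup>2
      = (1 - t) * (h m + (- t) * D m (z - x) + \<mu> / 2 * (t\<^sup>2 * (norm (z - x))\<^sup>2))
        + t * (h m + (1 - t) * D m (z - x) + \<mu> / 2 * ((1 - t)\<^sup>2 * (norm (z - x))\<^sup>2))"
    by (simp add: field_simps power2_eq_square)
  then show "h ((1 - t) *\<^sub>R x + t *\<^sub>R z) + \<mu> / 2 * t * (1 - t) * (norm (z - x))\<^sup>2
      \<le> (1 - t) * h x + t * h z"
    unfolding m_def[symmetric] using 1 2 by linarith
qed

text \<open>
  Minimality bounds the value at the convex combination from below by \<open>h x\<close>. Dividing the
  resulting inequality by \<open>t\<close> and letting \<open>t\<close> tend to zero gives the constant \<open>\<mu> / 2\<close>;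
  the midpoint alone would only give \<open>\<mu> / 4\<close>.
\<close>
lemma quadratic_growth_at_minimizer:
  fixes h :: "'u::real_normed_vector \<Rightarrow> real"
  assumes "convex C" and sc: "strongly_convex_on \<mu> C h"
    and x: "x \<in> C" "\<And>v. v \<in> C \<Longrightarrow> h x \<le> h v" and z: "z \<in> C"
  shows "h x + \<mu> / 2 * (norm (z - x))\<^sup>2 \<le> h z"
proof -
  have *: "\<mu> / 2 * (1 - t) * (norm (z - x))\<^sup>2 \<le> h z - h x" if t: "0 < t" "t \<le> 1" for t
  proof -
    have "(1 - t) *\<^sub>R x + t *\<^sub>R z \<in> C"
      using \<open>convex C\<close> x(1) z t by (simp add: convex_alt)
    then have "h x \<le> h ((1 - t) *\<^sub>R x + t *\<^sub>R z)"
      by (rule x(2))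
    moreover have "h ((1 - t) *\<^sub>R x + t *\<^sub>R z) + \<mu> / 2 * t * (1 - t) * (norm (z - x))\<^sup>2
        \<le> (1 - t) * h x + t * h z"
      using sc x(1) z t unfolding strongly_convex_on_def by auto
    ultimately have "t * (\<mu> / 2 * (1 - t) * (norm (z - x))\<^sup>2) \<le> t * (h z - h x)"
      by (simp add: algebra_simps)
    then show ?thesis using t(1) by simp
  qed
  have "((\<lambda>t. \<mu> / 2 * (1 - t) * (norm (z - x))\<^sup>2) \<longlongrightarrow> \<mu> / 2 * (1 - 0) * (norm (z - x))\<^sup>2)
      (at_right 0)"
    by (intro tendsto_intros)
  moreover have "\<forall>\<^sub>F t in at_right 0. \<mu> / 2 * (1 - t) * (norm (z - x))\<^sup>2 \<le> h z - h x"
    unfolding eventually_at_right_field by (rule exI[of _ 1]) (use * in force)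
  ultimately have "\<mu> / 2 * (1 - 0) * (norm (z - x))\<^sup>2 \<le> h z - h x"
    by (rule tendsto_upperbound) simp
  then show ?thesis by simp
qed

text \<open>
  Two near-minimizers are close to each other because their midpoint cannot fall below the
  infimum. Minimizing sequences are therefore Cauchy, so that completeness replaces the
  usual weak compactness argument.
\<close>
lemma strongly_convex_attains_minimum:
  fixes h :: "'u::{real_normed_vector, complete_space} \<Rightarrow> real"
  assumes C: "C \<noteq> {}" "closed C" "convex C"
    and sc: "strongly_convex_on \<mu> C h" and "\<mu> > 0"
    and cont: "continuous_on C h" and bdd: "bdd_below (h ` C)"
  shows "\<exists>x\<in>C. \<forall>v\<in>C. h x \<le> h v"
proof -
  define m where "m = Inf (h ` C)"
  have lower: "m \<le> h v" if "v \<in> C" for v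
    unfolding m_def using bdd that by (intro cInf_lower) auto
  have "\<exists>x\<in>C. h x < m + 1 / real (Suc n)" for n
  proof -
    have "\<exists>r\<in>h ` C. r < m + 1 / real (Suc n)"
      unfolding m_def by (rule cInf_lessD) (use C(1) in auto)
    then show ?thesis by auto
  qed
  then obtain X where X: "\<And>n. X n \<in> C" "\<And>n. h (X n) < m + 1 / real (Suc n)"
    by metis
  have close: "\<mu> / 8 * (norm (X i - X j))\<^sup>2 < 1 / real (Suc N)" if "N \<le> i" "N \<le> j" for i j N
  proof -
    have "(1 - 1/2) *\<^sub>R X j + (1/2) *\<^sub>R X i \<in> C"
      using C(3)[unfolded convex_alt, rule_format, of "X j" "X i" "1/2"] X(1) by simp
    then have "m \<le> h ((1 - 1/2) *\<^sub>R X j + (1/2) *\<^sub>R X i)"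
      by (rule lower)
    moreover have "h ((1 - 1/2) *\<^sub>R X j + (1/2) *\<^sub>R X i)
        + \<mu> / 2 * (1/2) * (1 - 1/2) * (norm (X i - X j))\<^sup>2 \<le> (1 - 1/2) * h (X j) + (1/2) * h (X i)"
      using sc[unfolded strongly_convex_on_def, rule_format, OF X(1) X(1), of "1/2" j i] by simp
    moreover have "h (X i) < m + 1 / real (Suc N)"
      using X(2)[of i] that frac_le[of 1 1 "real (Suc N)" "real (Suc i)"] by simp
    moreover have "h (X j) < m + 1 / real (Suc N)"
      using X(2)[of j] that frac_le[of 1 1 "real (Suc N)" "real (Suc j)"] by simp
    ultimately show ?thesis by simp
  qed
  have "Cauchy X"
  proof (rule metric_CauchyI)
    fix e :: real assume "e > 0"
    then obtain N where N: "inverse (real (Suc N)) < \<mu> / 8 * e\<^sup>2"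
      using reals_Archimedean[of "\<mu> / 8 * e\<^sup>2"] \<open>\<mu> > 0\<close> by auto
    have "dist (X i) (X j) < e" if "N \<le> i" "N \<le> j" for i j
    proof -
      have "\<mu> / 8 * (norm (X i - X j))\<^sup>2 < \<mu> / 8 * e\<^sup>2"
        using close[OF that] N by (simp add: inverse_eq_divide)
      then have "(norm (X i - X j))\<^sup>2 < e\<^sup>2"
        using \<open>\<mu> > 0\<close> by simp
      then show ?thesis
        using \<open>e > 0\<close> by (simp add: dist_norm power2_less_imp_less)
    qed
    then show "\<exists>N. \<forall>i\<ge>N. \<forall>j\<ge>N. dist (X i) (X j) < e" by blast
  qed
  then obtain x where lim: "X \<longlonglongrightarrow> x"
    using Cauchy_convergent_iff convergent_def by blast
  have x: "x \<in> C"
    using closed_sequentially[OF C(2)] X(1) lim by blast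
  have "(\<lambda>n. h (X n)) \<longlonglongrightarrow> h x"
    using cont X(1) x lim by (simp add: continuous_on_sequentially o_def)
  moreover have "(\<lambda>n. m + 1 / real (Suc n)) \<longlonglongrightarrow> m + 0"
    by (intro tendsto_add tendsto_const LIMSEQ_Suc[OF lim_1_over_n])
  ultimately have "h x \<le> m + 0"
    by (rule LIMSEQ_le) (use X(2) less_imp_le in blast)
  then show ?thesis using x lower by force
qed


section \<open>The lower-level problem\<close>

lemma inverse_op_solves_iff:
  assumes "isomorphism A"
  shows "blinfun_apply A y = d \<longleftrightarrow> y = blinfun_apply (inverse_op A) d"
proof -
  obtain A' where A': "A' o\<^sub>L A = id_blinfun" "A o\<^sub>L A' = id_blinfun"
    using assms unfolding isomorphism_def by blast
  have left: "A' (A x) = x" for x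
    using arg_cong[OF A'(1), of "\<lambda>C. blinfun_apply C x"] by simp
  have right: "A (A' x) = x" for x
    using arg_cong[OF A'(2), of "\<lambda>C. blinfun_apply C x"] by simp
  have "A'' = A'" if "A'' o\<^sub>L A = id_blinfun" for A''
  proof (rule blinfun_eqI)
    fix x
    show "A'' x = A' x"
      using arg_cong[OF that, of "\<lambda>C. blinfun_apply C (A' x)"] by (simp add: right)
  qed
  then have "inverse_op A = A'"
    unfolding inverse_op_def using A' by (intro the_equality) blast+
  with left right show ?thesis by metis
qed

text \<open>
  The operator equation determines the state from the control, so the lower-level problem
  is the minimization of the reduced functional over the admissible controls.
\<close>
lemma lower_sol_eq:
  assumes A: "isomorphism A" and S: "S = inverse_op A o\<^sub>L B"
    and u: "u \<in> Uad" "\<And>v. v \<in> Uad \<Longrightarrow> f (\<beta>, blinfun_apply S u, u) \<le> f (\<beta>, blinfun_apply S v, v)"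
    and unique: "\<And>v. v \<in> Uad \<Longrightarrow>
      f (\<beta>, blinfun_apply S v, v) \<le> f (\<beta>, blinfun_apply S u, u) \<Longrightarrow> v = u"
  shows "lower_sol f A B Uad \<beta> = (blinfun_apply S u, u)"
proof -
  have state: "blinfun_apply A z = blinfun_apply B v \<longleftrightarrow> z = blinfun_apply S v" for z v
    by (simp add: S inverse_op_solves_iff[OF A])
  show ?thesis
    unfolding lower_sol_def
  proof (rule the_equality)
    show "is_arg_min (\<lambda>(y, u). f (\<beta>, y, u)) (\<lambda>(y, u). u \<in> Uad \<and> blinfun_apply A y = blinfun_apply B u)
        (blinfun_apply S u, u)"
      using u by (auto simp: is_arg_min_def state not_less)
  next
    fix p
    assume "is_arg_min (\<lambda>(y, u). f (\<beta>, y, u))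
      (\<lambda>(y, u). u \<in> Uad \<and> blinfun_apply A y = blinfun_apply B u) p"
    then obtain v where p: "p = (blinfun_apply S v, v)" and v: "v \<in> Uad"
      and "\<not> f (\<beta>, blinfun_apply S u, u) < f (\<beta>, blinfun_apply S v, v)"
      using u(1) by (cases p) (auto simp: is_arg_min_def state)
    then have "v = u" by (intro unique) auto
    then show "p = (blinfun_apply S u, u)" using p by simp
  qed
qed


section \<open>Affine interpolation on simplices\<close>

lemma affine_interpolation_at_affine_independent:
  fixes C :: "'a::euclidean_space set" and \<phi> :: "'a \<Rightarrow> real"
  assumes "\<not> affine_dependent C"
  shows "\<exists>a b. \<forall>v\<in>C. a \<bullet> v + b = \<phi> v"
proof (cases "C = {}")
  case False
  then obtain c where c: "c \<in> C" by blast
  then have "independent ((\<lambda>x. - c + x) ` (C - {c}))"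
    using assms affine_dependent_iff_dependent2 by blast
  then obtain g :: "'a \<Rightarrow> real" where g: "linear g"
    "\<forall>x\<in>(\<lambda>x. - c + x) ` (C - {c}). g x = \<phi> (c + x) - \<phi> c"
    using linear_independent_extend[of "(\<lambda>x. - c + x) ` (C - {c})" "\<lambda>x. \<phi> (c + x) - \<phi> c"]
    by blast
  \<comment> \<open>\<open>adjoint g 1\<close> is the Riesz representative of the linear functional \<open>g\<close>.\<close>
  have inner: "adjoint g 1 \<bullet> x = g x" for x
    using adjoint_works[OF g(1), of x 1] by (simp add: inner_commute)
  have "g v = g c + (\<phi> v - \<phi> c)" if "v \<in> C" for v
  proof (cases "v = c")
    case False
    then have "g (- c + v) = \<phi> v - \<phi> c" using g(2) that by simp
    moreover have "g (- c + v) = g v - g c"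
      using linear_diff[OF g(1), of v c] by simp
    ultimately show ?thesis by simp
  qed simp
  then have "\<forall>v\<in>C. adjoint g 1 \<bullet> v + (\<phi> c - g c) = \<phi> v"
    by (simp add: inner)
  then show ?thesis by blast
qed simp

text \<open>
  Two affine functions that agree at the vertices agree on an affine set containing the
  vertices, which is the whole space since the simplex is non-degenerate.
\<close>
lemma affine_interpolation_on_simplex:
  fixes T :: "'a::euclidean_space set"
  assumes "int DIM('a) simplex T"
  shows "\<exists>a b. \<forall>x. affine_interpolant \<phi> T x = a \<bullet> x + b"
proof -
  obtain C where C: "\<not> affine_dependent C" "int (card C) = int DIM('a) + 1" "T = convex hull C"
    using assms unfolding simplex_def by blast
  have vertex: "v extreme_point_of T \<longleftrightarrow> v \<in> C" for v
    using C extreme_point_of_convex_hull_affine_independent by blast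
  have full: "affine hull C = UNIV"
    using C(1,2) by (intro affine_independent_span_eq) auto
  obtain a b where ab: "\<forall>v\<in>C. a \<bullet> v + b = \<phi> v"
    using affine_interpolation_at_affine_independent[OF C(1)] by blast
  have "affine_interpolant \<phi> T = (\<lambda>x. a \<bullet> x + b)"
    unfolding affine_interpolant_def
  proof (rule the_equality)
    fix \<xi>
    assume "(\<exists>a b. \<forall>x. \<xi> x = a \<bullet> x + b) \<and> (\<forall>v. v extreme_point_of T \<longrightarrow> \<xi> v = \<phi> v)"
    then obtain a' b' where \<xi>: "\<And>x. \<xi> x = a' \<bullet> x + b'" and interp: "\<And>v. v \<in> C \<Longrightarrow> \<xi> v = \<phi> v"
      using vertex by blast
    have "C \<subseteq> {x. (a' - a) \<bullet> x = b - b'}"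
      using interp ab by (auto simp: \<xi> inner_diff_left) (smt (verit))
    then have "affine hull C \<subseteq> {x. (a' - a) \<bullet> x = b - b'}"
      by (rule hull_minimal) (rule affine_hyperplane)
    then show "\<xi> = (\<lambda>x. a \<bullet> x + b)"
      unfolding full by (auto simp: fun_eq_iff \<xi> inner_diff_left algebra_simps)
  qed (use ab vertex in auto)
  then show ?thesis by auto
qed

lemma interior_simplex_ne:
  fixes T :: "'a::euclidean_space set"
  assumes "int DIM('a) simplex T"
  shows "interior T \<noteq> {}"
proof -
  obtain C where C: "\<not> affine_dependent C" "int (card C) = int DIM('a) + 1" "T = convex hull C"
    using assms unfolding simplex_def by blast
  then have "card C = Suc DIM('a)" by auto
  then show ?thesis using interior_convex_hull_eq_empty[of C] C by simp
qed


section \<open>Almost-everywhere bounds and Sobolev norms\<close>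

text \<open>
  A convex set with nonempty interior is contained in the closure of its interior, so a
  violation of the bound at one point, possibly on the boundary, produces by continuity a
  nonempty open set of violations.
\<close>
lemma continuous_AE_bound_everywhere:
  fixes k :: "'a::euclidean_space \<Rightarrow> real"
  assumes T: "convex T" "interior T \<noteq> {}" "T \<in> sets lebesgue"
    and k: "continuous_on T k" and ae: "AE x in lebesgue_on T. k x \<le> c" and "b \<in> T"
  shows "k b \<le> c"
proof (rule ccontr)
  assume "\<not> k b \<le> c"
  have "openin (top_of_set T) (T \<inter> k -` {c<..})"
    using k by (intro continuous_openin_preimage_gen) auto
  then obtain V where V: "open V" "T \<inter> k -` {c<..} = T \<inter> V"
    by (auto simp: openin_open)
  have "b \<in> V"
    using V(2) \<open>b \<in> T\<close> \<open>\<not> k b \<le> c\<close> by (metis IntD2 IntI greaterThan_iff not_le vimageI)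
  moreover have "b \<in> closure (interior T)"
    using convex_closure_interior[OF T(1,2)] \<open>b \<in> T\<close> closure_subset by blast
  ultimately have "V \<inter> interior T \<noteq> {}"
    using V(1) by (metis IntI disjoint_iff open_Int_closure_eq_empty)
  then have "\<not> negligible (V \<inter> interior T)"
    using V(1) by (intro open_not_negligible) auto
  moreover have "negligible (V \<inter> interior T)"
  proof -
    have "AE x in lebesgue. x \<in> T \<longrightarrow> k x \<le> c"
      using ae T(3) by (simp add: AE_restrict_space_iff)
    then obtain N where N: "N \<in> null_sets lebesgue" "{x. \<not> (x \<in> T \<longrightarrow> k x \<le> c)} \<subseteq> N"
      by (auto simp: eventually_ae_filter)
    have "V \<inter> interior T \<subseteq> N"
      using N(2) V(2) interior_subset[of T] by fastforce
    then show ?thesis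
      using N(1) negligible_iff_null_sets negligible_subset by blast
  qed
  ultimately show False by blast
qed

lemma Linf_norm_AE: "AE x in lebesgue_on \<Omega>. ereal \<bar>v x\<bar> \<le> Linf_norm \<Omega> v"
  unfolding Linf_norm_def by (rule esssup_AE)

lemma Linf_norm_mono:
  fixes v :: "'a::euclidean_space \<Rightarrow> real"
  assumes sub: "\<Omega>' \<subseteq> \<Omega>" and \<Omega>: "\<Omega>' \<in> sets lebesgue" "\<Omega> \<in> sets lebesgue"
  shows "Linf_norm \<Omega>' v \<le> Linf_norm \<Omega> v"
proof (cases "(\<lambda>x. ereal \<bar>v x\<bar>) \<in> borel_measurable (lebesgue_on \<Omega>)")
  case True
  have "restrict_space (lebesgue_on \<Omega>) \<Omega>' = lebesgue_on \<Omega>'"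
    using sub \<Omega> by (simp add: restrict_restrict_space Int_absorb1)
  then have meas: "(\<lambda>x. ereal \<bar>v x\<bar>) \<in> borel_measurable (lebesgue_on \<Omega>')"
    using measurable_restrict_space1[OF True, of \<Omega>'] by simp
  have "AE x in lebesgue_on \<Omega>'. ereal \<bar>v x\<bar> \<le> Linf_norm \<Omega> v"
    using Linf_norm_AE[where \<Omega> = \<Omega> and v = v] sub \<Omega> by (auto simp: AE_restrict_space_iff elim!: eventually_mono)
  then show ?thesis
    unfolding Linf_norm_def[of \<Omega>'] using meas by (intro esssup_I)
next
  case False
  then show ?thesis by (simp add: Linf_norm_def esssup_non_measurable top_ereal_def)
qed

text \<open>
  This fails for null sets, where the essential supremum in the extended reals is \<open>-\<infinity>\<close>; a
  nonempty open set has positive measure.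
\<close>
lemma Linf_norm_nonneg:
  fixes v :: "'a::euclidean_space \<Rightarrow> real"
  assumes "open \<Omega>" "\<Omega> \<noteq> {}"
  shows "0 \<le> Linf_norm \<Omega> v"
proof (rule ccontr)
  assume neg: "\<not> 0 \<le> Linf_norm \<Omega> v"
  have "AE x in lebesgue_on \<Omega>. False"
    using Linf_norm_AE[where \<Omega> = \<Omega> and v = v]
  proof (rule eventually_mono)
    fix x assume "ereal \<bar>v x\<bar> \<le> Linf_norm \<Omega> v"
    moreover have "0 \<le> ereal \<bar>v x\<bar>" by simp
    ultimately show False using neg order_trans by blast
  qed
  then have "AE x in lebesgue. x \<notin> \<Omega>"
    using assms(1) by (simp add: AE_restrict_space_iff)
  then have "\<Omega> \<in> null_sets lebesgue"
    using assms(1) by (simp add: AE_iff_null_sets)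
  then show False
    using open_not_negligible[OF assms] by (simp add: negligible_iff_null_sets)
qed

text \<open>
  A test function on the smaller set is one on the larger set, and since it vanishes near
  every point outside the smaller set, both integrals in the defining identity are unchanged.
\<close>
lemma weak_partial_subset:
  fixes v g :: "'a::euclidean_space \<Rightarrow> real"
  assumes sub: "\<Omega>' \<subseteq> \<Omega>" and w: "weak_partial \<Omega> i v g"
  shows "weak_partial \<Omega>' i v g"
proof -
  have "(LINT x:\<Omega>'|lebesgue. v x * frechet_derivative \<psi> (at x) i)
          = - (LINT x:\<Omega>'|lebesgue. g x * \<psi> x)" if \<psi>: "\<psi> \<in> test_functions \<Omega>'" for \<psi>
  proof -
    have supp: "closure {x. \<psi> x \<noteq> 0} \<subseteq> \<Omega>'"
      using \<psi> by (simp add: test_functions_def)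
    have deriv0: "frechet_derivative \<psi> (at x) i = 0" if "x \<notin> \<Omega>'" for x
    proof -
      have "frechet_derivative (\<lambda>_. 0 :: real) (at x) = frechet_derivative \<psi> (at x)"
      proof (rule frechet_derivative_transform_within_open)
        show "x \<in> - closure {x. \<psi> x \<noteq> 0}" using supp that by blast
        show "0 = \<psi> z" if "z \<in> - closure {x. \<psi> x \<noteq> 0}" for z
          using that closure_subset[of "{x. \<psi> x \<noteq> 0}"] by auto
      qed auto
      then show ?thesis by (metis frechet_derivative_const)
    qed
    have \<psi>0: "\<psi> x = 0" if "x \<notin> \<Omega>'" for x
      using supp that closure_subset[of "{x. \<psi> x \<noteq> 0}"] by auto
    have "(LINT x:\<Omega>'|lebesgue. v x * frechet_derivative \<psi> (at x) i)
        = (LINT x:\<Omega>|lebesgue. v x * frechet_derivative \<psi> (at x) i)"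
      unfolding set_lebesgue_integral_def
      by (rule Bochner_Integration.integral_cong) (use sub deriv0 in \<open>auto simp: indicator_def\<close>)
    moreover have "(LINT x:\<Omega>'|lebesgue. g x * \<psi> x) = (LINT x:\<Omega>|lebesgue. g x * \<psi> x)"
      unfolding set_lebesgue_integral_def
      by (rule Bochner_Integration.integral_cong) (use sub \<psi>0 in \<open>auto simp: indicator_def\<close>)
    moreover have "\<psi> \<in> test_functions \<Omega>"
      using \<psi> sub by (auto simp: test_functions_def)
    ultimately show ?thesis
      using w by (simp add: weak_partial_def)
  qed
  then show ?thesis
    using w sub unfolding weak_partial_def locally_integrable_def by (meson order_trans)
qed

text \<open>
  The norm over a single element is thereby controlled by the constant \<open>C\<^sub>\<phi>\<close> of the whole
  parameter domain: every pair of families of weak derivatives on the larger set competes in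
  the infimum for the smaller one, with a value that is no larger.
\<close>
lemma W2inf_norm_mono:
  fixes v :: "'a::euclidean_space \<Rightarrow> real"
  assumes sub: "\<Omega>' \<subseteq> \<Omega>" and "open \<Omega>'" "open \<Omega>"
  shows "W2inf_norm \<Omega>' v \<le> W2inf_norm \<Omega> v"
proof -
  have L: "Linf_norm \<Omega>' w \<le> Linf_norm \<Omega> w" for w :: "'a \<Rightarrow> real"
    using assms by (intro Linf_norm_mono) auto
  show ?thesis
    unfolding W2inf_norm_def
  proof (rule Inf_mono, clarify)
    fix g h
    assume g: "\<forall>i\<in>Basis. weak_partial \<Omega> i v (g i)"
      and h: "\<forall>i\<in>Basis. \<forall>j\<in>Basis. weak_partial \<Omega> j (g i) (h i j)"
    let ?N = "\<lambda>\<Omega>. Sup ({Linf_norm \<Omega> v} \<union> {Linf_norm \<Omega> (g i) | i. i \<in> Basis}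
                \<union> {Linf_norm \<Omega> (h i j) | i j. i \<in> Basis \<and> j \<in> Basis})"
    have "?N \<Omega>' \<le> ?N \<Omega>"
      by (rule Sup_mono) (use L in blast)
    then show "\<exists>a\<in>{Sup ({Linf_norm \<Omega>' v} \<union> {Linf_norm \<Omega>' (g i) | i. i \<in> Basis}
                \<union> {Linf_norm \<Omega>' (h i j) | i j. i \<in> Basis \<and> j \<in> Basis}) | g h.
            (\<forall>i\<in>Basis. weak_partial \<Omega>' i v (g i)) \<and>
            (\<forall>i\<in>Basis. \<forall>j\<in>Basis. weak_partial \<Omega>' j (g i) (h i j))}. a \<le> ?N \<Omega>"
      using g h weak_partial_subset[OF sub] by blast
  qed
qed

lemma W2inf_norm_nonneg:
  fixes v :: "'a::euclidean_space \<Rightarrow> real"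
  assumes "open \<Omega>" "\<Omega> \<noteq> {}"
  shows "0 \<le> W2inf_norm \<Omega> v"
  unfolding W2inf_norm_def
  by (rule Inf_greatest) (use Linf_norm_nonneg[OF assms, of v] in \<open>auto simp: le_max_iff_disj\<close>)


section \<open>Excluding elements away from the solution\<close>

theorem theorem3p5:
  fixes Q :: "(real ^ 'n) set"
    and Uad :: "'u::{real_inner, complete_space} set"
    and A :: "'y::{real_inner, complete_space} \<Rightarrow>\<^sub>L ('y \<Rightarrow>\<^sub>L real)"
    and B :: "'u \<Rightarrow>\<^sub>L ('y \<Rightarrow>\<^sub>L real)"
    and S :: "'u \<Rightarrow>\<^sub>L 'y"
    and F f :: "(real ^ 'n) \<times> 'y \<times> 'u \<Rightarrow> real"
    and L :: "real \<Rightarrow> real"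
    and \<mu> G \<rho> C\<^sub>\<rho> C\<^sub>\<phi> M\<^sub>\<Psi> M :: real
    and ys :: "real ^ 'n \<Rightarrow> 'y" and us :: "real ^ 'n \<Rightarrow> 'u"
    and \<phi> :: "real ^ 'n \<Rightarrow> real"
    and \<T> :: "(real ^ 'n) set set" and T :: "(real ^ 'n) set"
    and \<beta>' \<beta> :: "real ^ 'n" and y' y :: 'y and u' u :: 'u
  assumes Q: "polyhedron Q" "bounded Q" "interior Q \<noteq> {}"
    and Uad: "Uad \<noteq> {}" "closed Uad" "convex Uad"
    and A: "isomorphism A"
    and S: "S = inverse_op A o\<^sub>L B"
    and F: "bdd_below (F ` (Q \<times> UNIV \<times> UNIV))" "convex_on (Q \<times> UNIV \<times> UNIV) F"
           "cont_frechet_differentiable_on F (Q \<times> UNIV \<times> UNIV)"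
    and f: "bdd_below (f ` (Q \<times> UNIV \<times> UNIV))" "convex_on (Q \<times> UNIV \<times> UNIV) f"
           "cont_frechet_differentiable_on f (Q \<times> UNIV \<times> UNIV)"
    and L_nonneg: "\<And>m. m \<ge> 0 \<Longrightarrow> L m \<ge> 0"
    and Lipschitz_f_beta:
      "\<And>m \<beta>\<^sub>1 \<beta>\<^sub>2 y\<^sub>1 y\<^sub>2 u\<^sub>1 u\<^sub>2. \<lbrakk>m \<ge> 0; \<beta>\<^sub>1 \<in> Q; \<beta>\<^sub>2 \<in> Q; norm y\<^sub>1 \<le> m; norm y\<^sub>2 \<le> m;
          u\<^sub>1 \<in> Uad; u\<^sub>2 \<in> Uad; norm u\<^sub>1 \<le> m; norm u\<^sub>2 \<le> m\<rbrakk> \<Longrightarrow>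
        norm (deriv_beta Q f \<beta>\<^sub>1 y\<^sub>1 u\<^sub>1 - deriv_beta Q f \<beta>\<^sub>2 y\<^sub>2 u\<^sub>2)
          \<le> L m * (norm (\<beta>\<^sub>1 - \<beta>\<^sub>2) + norm (y\<^sub>1 - y\<^sub>2) + norm (u\<^sub>1 - u\<^sub>2))"
    and Lipschitz_F:
      "\<And>m \<beta> y\<^sub>1 y\<^sub>2 u\<^sub>1 u\<^sub>2. \<lbrakk>m \<ge> 0; \<beta> \<in> Q; norm y\<^sub>1 \<le> m; norm y\<^sub>2 \<le> m;
          u\<^sub>1 \<in> Uad; u\<^sub>2 \<in> Uad; norm u\<^sub>1 \<le> m; norm u\<^sub>2 \<le> m\<rbrakk> \<Longrightarrow>
        \<bar>F (\<beta>, y\<^sub>1, u\<^sub>1) - F (\<beta>, y\<^sub>2, u\<^sub>2)\<bar> \<le> L m * (norm (y\<^sub>1 - y\<^sub>2) + norm (u\<^sub>1 - u\<^sub>2))"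
    and Lipschitz_f_u:
      "\<And>m \<beta>\<^sub>1 \<beta>\<^sub>2 u. \<lbrakk>m \<ge> 0; \<beta>\<^sub>1 \<in> Q; \<beta>\<^sub>2 \<in> Q; u \<in> Uad; norm u \<le> m\<rbrakk> \<Longrightarrow>
        norm (deriv_u f \<beta>\<^sub>1 (S u) u - deriv_u f \<beta>\<^sub>2 (S u) u) \<le> L m * norm (\<beta>\<^sub>1 - \<beta>\<^sub>2)"
    and Lipschitz_f_y:
      "\<And>m \<beta>\<^sub>1 \<beta>\<^sub>2 u. \<lbrakk>m \<ge> 0; \<beta>\<^sub>1 \<in> Q; \<beta>\<^sub>2 \<in> Q; u \<in> Uad; norm u \<le> m\<rbrakk> \<Longrightarrow>
        norm (deriv_y f \<beta>\<^sub>1 (S u) u - deriv_y f \<beta>\<^sub>2 (S u) u) \<le> L m * norm (\<beta>\<^sub>1 - \<beta>\<^sub>2)"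
    and \<mu>: "\<mu> > 0"
    and strong_convexity:
      "\<And>\<beta> u\<^sub>1 u\<^sub>2. \<lbrakk>\<beta> \<in> Q; u\<^sub>1 \<in> Uad; u\<^sub>2 \<in> Uad\<rbrakk> \<Longrightarrow>
        f (\<beta>, S u\<^sub>2, u\<^sub>2) \<ge> f (\<beta>, S u\<^sub>1, u\<^sub>1)
          + deriv_y f \<beta> (S u\<^sub>1) u\<^sub>1 (S (u\<^sub>2 - u\<^sub>1)) + deriv_u f \<beta> (S u\<^sub>1) u\<^sub>1 (u\<^sub>2 - u\<^sub>1)
          + \<mu> / 2 * (norm (u\<^sub>2 - u\<^sub>1))\<^sup>2"
    and ys: "ys = (\<lambda>\<beta>. fst (lower_sol f A B Uad \<beta>))"
    and us: "us = (\<lambda>\<beta>. snd (lower_sol f A B Uad \<beta>))"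
    and \<phi>: "\<phi> = opt_value f A B Uad"
    and \<phi>_regular: "\<phi> \<in> W2inf (interior Q)"
    and C\<^sub>\<phi>: "C\<^sub>\<phi> = real_of_ereal (W2inf_norm (interior Q) \<phi>)"
    and subdiv: "subdivision Q \<T>"
    and \<rho>: "\<rho> > 0" "\<And>T'. T' \<in> \<T> \<Longrightarrow> \<rho> \<le> aspect_ratio T'"
    and C\<^sub>\<rho>: "C\<^sub>\<rho> > 0"
    and interpolation_estimate:
      "\<And>T'. \<lbrakk>int CARD('n) simplex T'; T' \<subseteq> Q; \<rho> \<le> aspect_ratio T'\<rbrakk> \<Longrightarrow>
        Linf_norm T' (\<lambda>b. affine_interpolant \<phi> T' b - \<phi> b)
          \<le> ereal (C\<^sub>\<rho> * (diameter T')\<^sup>2) * W2inf_norm (interior T') \<phi>"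
    and M\<^sub>\<Psi>: "M\<^sub>\<Psi> \<ge> 0"
      "\<And>\<beta>. \<beta> \<in> Q \<Longrightarrow> norm \<beta> \<le> M\<^sub>\<Psi> \<and> norm (ys \<beta>) \<le> M\<^sub>\<Psi> \<and> norm (us \<beta>) \<le> M\<^sub>\<Psi>"
    and M: "M = M\<^sub>\<Psi> + max 1 (norm S) * sqrt (2 * C\<^sub>\<rho> * C\<^sub>\<phi> / \<mu>) * diameter Q"
    and solution: "solves_OVR Q Uad A B f F (\<beta>', y', u')"
    and G: "G > 0"
    and growth: "\<And>\<beta>. \<beta> \<in> Q \<Longrightarrow> F (\<beta>, ys \<beta>, us \<beta>) \<ge> F (\<beta>', y', u') + G * (norm (\<beta> - \<beta>'))\<^sup>2"
    and T: "T \<in> \<T>"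
    \<comment> \<open>The quotient is taken in the extended reals, so that it is infinite for a zero denominator.\<close>
    and diam_T: "ereal (diameter T) <
      ereal G / ereal (L M * (1 + norm S) * sqrt (2 * C\<^sub>\<rho> * C\<^sub>\<phi> / \<mu>)) * ereal ((infdist \<beta>' T)\<^sup>2)"
    and point: "\<beta> \<in> T" "f (\<beta>, y, u) \<le> affine_interpolant \<phi> T \<beta>" "A y - B u = 0" "u \<in> Uad"
  shows "F (\<beta>, y, u) > F (\<beta>', y', u')"
proof -
  have dim: "DIM(real ^ 'n) = CARD('n)" by simp
  have simplex: "int DIM(real ^ 'n) simplex T" and TQ: "T \<subseteq> Q"
    using subdiv T unfolding subdivision_def dim by auto
  have \<beta>Q: "\<beta> \<in> Q" using TQ point(1) by blast
  have yS: "y = S u"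
    using point(3) by (simp add: S inverse_op_solves_iff[OF A])

  have f_cont: "continuous_on (Q \<times> UNIV \<times> UNIV) f"
    using f(3) differentiable_imp_continuous_on
    unfolding cont_frechet_differentiable_on_def by blast
  have sc: "strongly_convex_on \<mu> Uad (\<lambda>v. f (b, S v, v))" if "b \<in> Q" for b
  proof (rule strongly_convex_on_if_gradient_inequality[OF Uad(3)])
    fix v
    show "linear (\<lambda>w. deriv_y f b (S v) v (S w) + deriv_u f b (S v) v w)"
      by (intro linear_compose_add) (auto intro!: linearI simp: blinfun.bilinear_simps)
  next
    fix v w assume "v \<in> Uad" "w \<in> Uad"
    then show "f (b, S w, w) \<ge> f (b, S v, v)
        + (deriv_y f b (S v) v (S (w - v)) + deriv_u f b (S v) v (w - v)) + \<mu> / 2 * (norm (w - v))\<^sup>2"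
      using strong_convexity[OF that] by force
  qed
  have minimizer: "\<exists>w\<in>Uad. (\<forall>v\<in>Uad. f (b, S w, w) \<le> f (b, S v, v)) \<and>
      lower_sol f A B Uad b = (S w, w)" if b: "b \<in> Q" for b
  proof -
    have "continuous_on Uad (\<lambda>v. f (b, S v, v))"
      by (rule continuous_on_compose2[OF f_cont]) (use b in \<open>auto intro!: continuous_intros\<close>)
    moreover have "bdd_below ((\<lambda>v. f (b, S v, v)) ` Uad)"
      by (rule bdd_below_mono[OF f(1)]) (use b in auto)
    ultimately obtain w where w: "w \<in> Uad" "\<forall>v\<in>Uad. f (b, S w, w) \<le> f (b, S v, v)"
      using strongly_convex_attains_minimum[OF Uad sc[OF b] \<mu>] by blast
    have "v = w" if v: "v \<in> Uad" "f (b, S v, v) \<le> f (b, S w, w)" for v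
    proof -
      have "\<mu> / 2 * (norm (v - w))\<^sup>2 \<le> 0"
        using quadratic_growth_at_minimizer[OF Uad(3) sc[OF b] w(1) _ v(1)] w(2) v(2) by force
      then show ?thesis
        using \<mu> by (simp add: mult_le_0_iff)
    qed
    then have "lower_sol f A B Uad b = (S w, w)"
      using w by (intro lower_sol_eq[OF A S]) auto
    then show ?thesis using w by blast
  qed
  have us: "us b \<in> Uad" and usmin: "v \<in> Uad \<Longrightarrow> f (b, S (us b), us b) \<le> f (b, S v, v)"
    and ysus: "ys b = S (us b)" and \<phi>eq: "\<phi> b = f (b, S (us b), us b)" if "b \<in> Q" for b v
    using minimizer[OF that] unfolding us ys \<phi> opt_value_def by auto

  \<comment> \<open>A norm in \<open>[0, \<infinity>)\<close> is recovered from its real value \<open>C\<^sub>\<phi>\<close>.\<close>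
  have intQ: "0 \<le> W2inf_norm (interior Q) \<phi>"
    using Q(3) by (intro W2inf_norm_nonneg) auto
  have W: "W2inf_norm (interior Q) \<phi> = ereal C\<^sub>\<phi>" and C0: "C\<^sub>\<phi> \<ge> 0"
    using intQ \<phi>_regular unfolding C\<^sub>\<phi> W2inf_def
    by (cases "W2inf_norm (interior Q) \<phi>"; simp)+
  define d where "d = diameter T"
  have d0: "0 \<le> d" and dQ: "d \<le> diameter Q"
    unfolding d_def using diameter_subset[OF TQ Q(2)]
      diameter_ge_0[OF bounded_subset[OF Q(2) TQ]] by auto
  have "Linf_norm T (\<lambda>b. affine_interpolant \<phi> T b - \<phi> b)
      \<le> ereal (C\<^sub>\<rho> * d\<^sup>2) * W2inf_norm (interior T) \<phi>"
    unfolding d_def using simplex dim TQ \<rho>(2)[OF T] by (intro interpolation_estimate) auto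
  also have "\<dots> \<le> ereal (C\<^sub>\<rho> * d\<^sup>2) * ereal C\<^sub>\<phi>"
    unfolding W[symmetric]
    using C\<^sub>\<rho> by (intro ereal_mult_left_mono W2inf_norm_mono interior_mono TQ) auto
  finally have Linf: "Linf_norm T (\<lambda>b. affine_interpolant \<phi> T b - \<phi> b) \<le> ereal (C\<^sub>\<rho> * d\<^sup>2 * C\<^sub>\<phi>)"
    by simp
  \<comment> \<open>The lower-level solution is frozen at \<open>\<beta>\<close> to obtain a continuous function of the parameter.\<close>
  have "affine_interpolant \<phi> T \<beta> - f (\<beta>, S (us \<beta>), us \<beta>) \<le> C\<^sub>\<rho> * d\<^sup>2 * C\<^sub>\<phi>"
  proof (rule continuous_AE_bound_everywhere[where T = T and
        k = "\<lambda>b. affine_interpolant \<phi> T b - f (b, S (us \<beta>), us \<beta>)"])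
    show "continuous_on T (\<lambda>b. affine_interpolant \<phi> T b - f (b, S (us \<beta>), us \<beta>))"
    proof (rule continuous_on_diff)
      obtain a c where "\<And>x. affine_interpolant \<phi> T x = a \<bullet> x + c"
        using affine_interpolation_on_simplex[OF simplex] by blast
      then show "continuous_on T (affine_interpolant \<phi> T)"
        by (simp add: continuous_intros cong: continuous_on_cong)
      show "continuous_on T (\<lambda>b. f (b, S (us \<beta>), us \<beta>))"
        by (rule continuous_on_compose2[OF f_cont]) (use TQ in \<open>auto intro!: continuous_intros\<close>)
    qed
    show "T \<in> sets lebesgue"
      using closed_simplex[OF simplex] by simp
    have "AE b in lebesgue_on T. ereal \<bar>affine_interpolant \<phi> T b - \<phi> b\<bar> \<le> ereal (C\<^sub>\<rho> * d\<^sup>2 * C\<^sub>\<phi>)"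
      using Linf_norm_AE by (rule eventually_mono) (rule order_trans[OF _ Linf])
    then show "AE b in lebesgue_on T. affine_interpolant \<phi> T b - f (b, S (us \<beta>), us \<beta>) \<le> C\<^sub>\<rho> * d\<^sup>2 * C\<^sub>\<phi>"
      using AE_space
    proof eventually_elim
      case (elim b)
      then have "b \<in> Q" using TQ by auto
      then have "\<phi> b \<le> f (b, S (us \<beta>), us \<beta>)"
        using usmin us[OF \<beta>Q] \<phi>eq by simp
      then show ?case using elim(1) by simp
    qed
  qed (use convex_simplex[OF simplex] interior_simplex_ne[OF simplex] point(1) in auto)

  then have "\<mu> / 2 * (norm (u - us \<beta>))\<^sup>2 \<le> C\<^sub>\<rho> * d\<^sup>2 * C\<^sub>\<phi>"
    using quadratic_growth_at_minimizer[OF Uad(3) sc[OF \<beta>Q] us[OF \<beta>Q] usmin[OF \<beta>Q] point(4)]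
      point(2) yS by simp
  then have sq: "(norm (u - us \<beta>))\<^sup>2 \<le> 2 * C\<^sub>\<rho> * C\<^sub>\<phi> / \<mu> * d\<^sup>2"
    using \<mu> by (simp add: field_simps)
  define s where "s = sqrt (2 * C\<^sub>\<rho> * C\<^sub>\<phi> / \<mu>)"
  have s0: "s \<ge> 0" unfolding s_def using \<mu> C0 C\<^sub>\<rho> by simp
  have "s\<^sup>2 = 2 * C\<^sub>\<rho> * C\<^sub>\<phi> / \<mu>"
    unfolding s_def using \<mu> C0 C\<^sub>\<rho> by simp
  then have "(norm (u - us \<beta>))\<^sup>2 \<le> (s * d)\<^sup>2"
    using sq by (simp add: power_mult_distrib)
  then have du: "norm (u - us \<beta>) \<le> s * d"
    by (rule power2_le_imp_le) (use s0 d0 in simp)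
  have "norm (y - ys \<beta>) \<le> norm S * norm (u - us \<beta>)"
    using norm_blinfun[of S "u - us \<beta>"] by (simp add: yS ysus[OF \<beta>Q] blinfun.diff_right)
  also have "\<dots> \<le> norm S * (s * d)"
    using du by (rule mult_left_mono) simp
  finally have dy: "norm (y - ys \<beta>) \<le> norm S * (s * d)" .

  \<comment> \<open>\<open>M\<close> exceeds \<open>M\<^sub>\<Psi>\<close> by a common bound \<open>e\<close> of both distances, so \<open>(y, u)\<close> lies where \<open>L M\<close> applies.\<close>
  define e where "e = max 1 (norm S) * s * diameter Q"
  have MM: "M = M\<^sub>\<Psi> + e" by (simp add: M e_def s_def)
  have "1 * (s * d) \<le> max 1 (norm S) * (s * diameter Q)"
    and "norm S * (s * d) \<le> max 1 (norm S) * (s * diameter Q)"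
    using s0 d0 dQ by (intro mult_mono; simp)+
  then have e: "s * d \<le> e" "norm S * (s * d) \<le> e"
    by (simp_all add: e_def mult.assoc)
  have e0: "0 \<le> e" using e(1) s0 d0 by (meson mult_nonneg_nonneg order_trans)
  have bounds: "norm (ys \<beta>) \<le> M\<^sub>\<Psi>" "norm (us \<beta>) \<le> M\<^sub>\<Psi>"
    using M\<^sub>\<Psi>(2)[OF \<beta>Q] by auto
  have "norm u \<le> M"
    using norm_triangle_ineq[of "us \<beta>" "u - us \<beta>"] bounds du e(1) MM by simp
  moreover have "norm y \<le> M"
    using norm_triangle_ineq[of "ys \<beta>" "y - ys \<beta>"] bounds dy e(2) MM by simp
  moreover have M0: "0 \<le> M" using MM M\<^sub>\<Psi>(1) e0 by simp
  ultimately have lip: "\<bar>F (\<beta>, y, u) - F (\<beta>, ys \<beta>, us \<beta>)\<bar>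
      \<le> L M * (norm (y - ys \<beta>) + norm (u - us \<beta>))"
    using bounds e0 MM us[OF \<beta>Q] point(4) by (intro Lipschitz_F \<beta>Q) auto
  define K where "K = L M * (1 + norm S) * s"
  have K0: "0 \<le> K" unfolding K_def using L_nonneg[OF M0] s0 by simp
  have "L M * (norm (y - ys \<beta>) + norm (u - us \<beta>)) \<le> L M * (norm S * (s * d) + s * d)"
    using dy du L_nonneg[OF M0] by (intro mult_left_mono) auto
  also have "\<dots> = K * d" by (simp add: K_def algebra_simps)
  finally have loss: "F (\<beta>, y, u) \<ge> F (\<beta>, ys \<beta>, us \<beta>) - K * d" using lip by linarith

  define r where "r = infdist \<beta>' T"
  have r0: "0 \<le> r" by (simp add: r_def infdist_nonneg)
  have "r \<le> norm (\<beta> - \<beta>')"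
    using infdist_le[OF point(1), of \<beta>'] by (simp add: r_def dist_norm norm_minus_commute)
  then have "r\<^sup>2 \<le> (norm (\<beta> - \<beta>'))\<^sup>2" using r0 by (intro power_mono) auto
  then have gain: "F (\<beta>, ys \<beta>, us \<beta>) \<ge> F (\<beta>', y', u') + G * r\<^sup>2"
    using growth[OF \<beta>Q] G by (smt (verit) mult_left_mono)
  have diam: "ereal d < ereal G / ereal K * ereal (r\<^sup>2)"
    using diam_T by (simp add: d_def K_def s_def r_def)
  have "K * d < G * r\<^sup>2"
  proof (cases "K = 0")
    case True
    \<comment> \<open>The bound on the diameter is \<open>\<infinity> * r\<^sup>2\<close>, which is zero for \<open>r = 0\<close> and then cannot
        exceed a diameter. So \<open>r > 0\<close>, and the growth alone is strict.\<close>
    have "r \<noteq> 0" using diam d0 by (auto simp: zero_ereal_def[symmetric])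
    then show ?thesis using True G by simp
  next
    case False
    then have "d < G / K * r\<^sup>2" using diam by simp
    then show ?thesis using False K0 by (simp add: field_simps)
  qed
  then show ?thesis using loss gain by linarith
qed

end
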